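(* Consider the weighted spider network $G$ with $N$ legs and parameters $\gamma=(\gamma_1,\gamma_2^{(1)},\dots,\gamma_2^{(N)},\gamma_3)\in\mathbb R_+\times(\mathbb R_+^* )^{N+1}$. Put $\mathcal S_2=\gamma_2^{(1)}+\cdots+\gamma_2^{(N)}$ and assume $\Lambda=2\gamma_3-\gamma_1-\mathcal S_2>0$. Then there exists an infinite collection of MERWs on $G$, generated by a finite number $N$ of linearly independent eigenfunctions $\{\psi^{(i)}:1\le i\le N\}$ of $A$ (associated with its spectral radius $\rho=2\gamma_3$), given, for all $1\le k\le N$ and $n\ge0$, by $$\psi^{(i)}((n,k))=1+\delta_{i,k}\frac{\Lambda}{\gamma_2^{(k)}}\,n .$$ More precisely, there exists a one-to-one correspondence between MERWs on $G$ and probability distributions $\mu=(\mu_i)_{1\le i\le N}$ on $\{1,\dots,N\}$, through the eigenfunction $$\psi^{(\mu)}=\sum_{i=1}^N\mu_i\psi^{(i)} .$$ The associated transition probabilities are, for all $1\le k\le N$ and $n\ge1$, $$P^{(\mu)}((n,k),(n\pm1,k))=\frac12\,\frac{\gamma_2^{(k)}+\mu_k\Lambda(n\pm1)}{\gamma_2^{(k)}+\mu_k\Lambda n},\quad P^{(\mu)}(\mathbf 0,(1,k))=\frac{\gamma_2^{(k)}+\mu_k\Lambda}{2\gamma_3},\quad P^{(\mu)}(\mathbf 0,\mathbf 0)=\frac{\gamma_1}{2\gamma_3}.$$ Furthermore, if $\mathbb P^\mu_{\mathbf 0}$ denotes the distribution of the MERW $(X_n)_{n\ge0}$ associated with $\mu$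 and started from $\mathbf 0$, then for all $1\le k\le N$, $$\mathbb P^\mu_{\mathbf 0}\Big(\lim_{n\to\infty}X_n=\infty_k\Big)=\mu_k .$$
   Context: The weighted spider network has vertex set $G=\{(n,k):n\in\mathbb N_0,\ 1\le k\le N\}$ with the identification $\mathbf 0=(0,1)=\cdots=(0,N)$. Its weighted adjacency matrix $A$ is given, for $n\ge1$ and $1\le k\le N$, by $A(\mathbf 0,\mathbf 0)=\gamma_1$, $A(\mathbf 0,(1,k))=\gamma_2^{(k)}$, $A((n,k),(n\pm1,k))=\gamma_3$, and $A=0$ otherwise. Here $\mathbb R_+=[0,\infty)$ and $\mathbb R_+^*=(0,\infty)$; $\delta_{i,k}=1$ if $i=k$ and $0$ otherwise. The combinatorial spectral radius $\rho$ is the inverse of the radius of convergence of $\sum_{n\ge0}A^n(x,y)z^n$, which does not depend on $x,y\in G$; it equals $2\gamma_3$ when $\Lambda\ge0$. A MERW (maximal entropy random walk) on $G$ is a Markov chain with kernel $P(x,y)=A(x,y)\frac{\psi(y)}{\rho\,\psi(x)}$, where $\psi:G\to(0,\infty)$ satisfies $A\psi=\rho\psi$. $\infty_1,\dots,\infty_N$ are the points of the geometric boundary of $G$, $\infty_k$ being the end of the $k$-th leg: $\lim_n X_n=\infty_k$ means that eventually $X_n$ lies on leg $k$ (second coordinate $k$) and its first coordinate tends to $+\infty$.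
   Formalization: The claim that the collection of MERWs is infinite is stated only for N ≥ 2 legs, since for N = 1 there is exactly one probability distribution on {1} and hence exactly one MERW; all other claims are stated for every N ≥ 1. *)

theory Defs
  imports "HOL-Probability.Probability"
begin

section \<open>Nonnegative matrices over a vertex type, and maximal entropy random walks\<close>

definition mat_app :: "('v \<Rightarrow> 'v \<Rightarrow> real) \<Rightarrow> ('v \<Rightarrow> real) \<Rightarrow> 'v \<Rightarrow> real" where
  "mat_app A f x = (\<Sum>\<^sub>\<infinity>y. A x y * f y)"

primrec mat_pow :: "('v \<Rightarrow> 'v \<Rightarrow> real) \<Rightarrow> nat \<Rightarrow> 'v \<Rightarrow> 'v \<Rightarrow> real" where
  "mat_pow A 0 x y = (if x = y then 1 else 0)"
| "mat_pow A (Suc n) x y = (\<Sum>\<^sub>\<infinity>z. A x z * mat_pow A n z y)"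

text \<open>The inverse of the radius of convergence of the power series with coefficients
  \<open>A\<^sup>n(x, y)\<close>; for irreducible \<open>A\<close> it does not depend on \<open>x\<close> and \<open>y\<close>.\<close>

definition spectral_radius_at :: "('v \<Rightarrow> 'v \<Rightarrow> real) \<Rightarrow> 'v \<Rightarrow> 'v \<Rightarrow> ereal" where
  "spectral_radius_at A x y = inverse (conv_radius (\<lambda>n. mat_pow A n x y))"

definition is_comb_spectral_radius :: "('v \<Rightarrow> 'v \<Rightarrow> real) \<Rightarrow> real \<Rightarrow> bool" where
  "is_comb_spectral_radius A \<rho> \<longleftrightarrow> (\<forall>x y. spectral_radius_at A x y = ereal \<rho>)"

definition pos_eigenfunction :: "('v \<Rightarrow> 'v \<Rightarrow> real) \<Rightarrow> real \<Rightarrow> ('v \<Rightarrow> real) \<Rightarrow> bool" where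
  "pos_eigenfunction A \<rho> \<psi> \<longleftrightarrow> (\<forall>x. \<psi> x > 0) \<and> (\<forall>x. mat_app A \<psi> x = \<rho> * \<psi> x)"

definition merw_kernel ::
    "('v \<Rightarrow> 'v \<Rightarrow> real) \<Rightarrow> real \<Rightarrow> ('v \<Rightarrow> real) \<Rightarrow> 'v \<Rightarrow> 'v \<Rightarrow> real" where
  "merw_kernel A \<rho> \<psi> x y = A x y * (\<psi> y / (\<rho> * \<psi> x))"

text \<open>A MERW is identified with its transition kernel; the starting point is left free.\<close>

definition is_merw :: "('v \<Rightarrow> 'v \<Rightarrow> real) \<Rightarrow> ('v \<Rightarrow> 'v \<Rightarrow> real) \<Rightarrow> bool" where
  "is_merw A P \<longleftrightarrow>
     (\<exists>\<rho> \<psi>. is_comb_spectral_radius A \<rho> \<and> pos_eigenfunction A \<rho> \<psi> \<and> P = merw_kernel A \<rho> \<psi>)"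

text \<open>\<open>M\<close> is the distribution, on the space of trajectories with its product sigma-algebra, of
  the Markov chain with kernel \<open>P\<close> started from \<open>x\<close>, given by its finite-dimensional
  distributions. This is meant for a countable state space.\<close>

definition is_markov_law ::
    "('v \<Rightarrow> 'v \<Rightarrow> real) \<Rightarrow> 'v \<Rightarrow> (nat \<Rightarrow> 'v) measure \<Rightarrow> bool" where
  "is_markov_law P x M \<longleftrightarrow>
     prob_space M \<and>
     sets M = sets (Pi\<^sub>M UNIV (\<lambda>_. count_space UNIV)) \<and>
     (\<forall>n v. measure M {\<omega> \<in> space M. \<forall>i\<le>n. \<omega> i = v i} =
        (if v 0 = x then \<Prod>i<n. P (v i) (v (Suc i)) else 0))"


section \<open>The weighted spider network\<close>

text \<open>The legs are indexed by a finite type \<open>'k\<close>, so that \<open>N = CARD('k)\<close>. The vertex \<open>(n, k)\<close> of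
  the paper is \<open>vtx n k\<close>: it is \<open>Origin\<close> for \<open>n = 0\<close> and \<open>Leg (n - 1) k\<close> for \<open>n \<ge> 1\<close>; thus the
  first argument of \<open>Leg\<close> is shifted by one.\<close>

datatype 'k spider = Origin | Leg nat 'k

fun vtx :: "nat \<Rightarrow> 'k \<Rightarrow> 'k spider" where
  "vtx 0 k = Origin"
| "vtx (Suc m) k = Leg m k"

fun level :: "'k spider \<Rightarrow> nat" where
  "level Origin = 0"
| "level (Leg m k) = Suc m"

lemma vtx_eq_iff: "vtx n k = vtx m l \<longleftrightarrow> n = m \<and> (n = 0 \<or> k = l)"
  by (cases n; cases m) auto

lemma vtx_cases: "\<exists>n k. x = vtx n k"
  by (cases x) (metis vtx.simps)+

lemma level_vtx [simp]: "level (vtx n k) = n"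
  by (cases n) auto

fun spider_adj ::
    "real \<Rightarrow> ('k \<Rightarrow> real) \<Rightarrow> real \<Rightarrow> 'k spider \<Rightarrow> 'k spider \<Rightarrow> real" where
  "spider_adj \<gamma>1 \<gamma>2 \<gamma>3 Origin Origin = \<gamma>1"
| "spider_adj \<gamma>1 \<gamma>2 \<gamma>3 Origin (Leg m k) = (if m = 0 then \<gamma>2 k else 0)"
| "spider_adj \<gamma>1 \<gamma>2 \<gamma>3 (Leg m k) Origin = (if m = 0 then \<gamma>3 else 0)"
| "spider_adj \<gamma>1 \<gamma>2 \<gamma>3 (Leg m k) (Leg n l) =
     (if k = l \<and> (n = Suc m \<or> m = Suc n) then \<gamma>3 else 0)"

lemma spider_adj_Origin_vtx:
  "spider_adj \<gamma>1 \<gamma>2 \<gamma>3 Origin (vtx n k) = (if n = 0 then \<gamma>1 else if n = 1 then \<gamma>2 k else 0)"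
  by (cases n) auto

lemma spider_adj_vtx:
  assumes "n \<ge> 1"
  shows "spider_adj \<gamma>1 \<gamma>2 \<gamma>3 (vtx n k) y =
           (if y = vtx (n + 1) k \<or> y = vtx (n - 1) k then \<gamma>3 else 0)"
proof -
  obtain m where n: "n = Suc m"
    using assms by (cases n) auto
  show ?thesis
    by (cases m; cases y) (auto simp: n)
qed

definition spider_drift :: "real \<Rightarrow> ('k::finite \<Rightarrow> real) \<Rightarrow> real \<Rightarrow> real" where
  "spider_drift \<gamma>1 \<gamma>2 \<gamma>3 = 2 * \<gamma>3 - \<gamma>1 - (\<Sum>k\<in>UNIV. \<gamma>2 k)"

fun spider_psi ::
    "real \<Rightarrow> ('k::finite \<Rightarrow> real) \<Rightarrow> real \<Rightarrow> 'k \<Rightarrow> 'k spider \<Rightarrow> real" where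
  "spider_psi \<gamma>1 \<gamma>2 \<gamma>3 i Origin = 1"
| "spider_psi \<gamma>1 \<gamma>2 \<gamma>3 i (Leg m k) =
     1 + (if i = k then 1 else 0) * (spider_drift \<gamma>1 \<gamma>2 \<gamma>3 / \<gamma>2 k) * real (Suc m)"

definition spider_psi_mix ::
    "real \<Rightarrow> ('k::finite \<Rightarrow> real) \<Rightarrow> real \<Rightarrow> 'k pmf \<Rightarrow> 'k spider \<Rightarrow> real" where
  "spider_psi_mix \<gamma>1 \<gamma>2 \<gamma>3 \<mu> x = (\<Sum>i\<in>UNIV. pmf \<mu> i * spider_psi \<gamma>1 \<gamma>2 \<gamma>3 i x)"

definition tends_to_end :: "(nat \<Rightarrow> 'k spider) \<Rightarrow> 'k \<Rightarrow> bool" where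
  "tends_to_end \<omega> k \<longleftrightarrow>
     (\<forall>\<^sub>F n in sequentially. \<exists>m. \<omega> n = vtx m k) \<and>
     filterlim (\<lambda>n. level (\<omega> n)) at_top sequentially"

end

theory Submission
  imports Defs
begin

text \<open>On a leg the eigenvalue equation says that \<open>\<psi>\<close> is affine, and positivity forces nonnegative
  slopes; the equation at the origin then fixes a weighted sum of the slopes, so that up to
  scaling positive eigenfunctions are parametrised by probability vectors. The spectral radius is
  at most \<open>2 * \<gamma>3\<close> because constants are superharmonic, and at least that because a Green function
  finite beyond \<open>1 / (2 * \<gamma>3)\<close> would be positive and strictly concave along a leg.

  For the limit behaviour, explicit superharmonic functions show that every vertex is transient,
  so the walk almost surely converges to some end. By Fatou, the harmonic function
  \<open>\<psi>\<^sub>k / \<psi>\<^sub>\<mu>\<close>, which equals \<open>1\<close> at the origin and tends to \<open>1 / \<mu>\<^sub>k\<close> (possibly \<open>\<infinity>\<close>)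
  along leg \<open>k\<close>, shows that the probability of converging to the \<open>k\<close>-th end is at most \<open>\<mu>\<^sub>k\<close>.
  Both families sum to one, so equality holds.\<close>

section \<open>Markov chains on a countable state space\<close>

text \<open>Row sums are nonnegative integrals over the counting measure, so the equation with
  \<open>1\<close> includes summability of each row and has the form required by
  \<open>pmf_embed_pmf\<close>.\<close>

definition stochastic :: "('v \<Rightarrow> 'v \<Rightarrow> real) \<Rightarrow> bool" where
  "stochastic P \<longleftrightarrow>
     (\<forall>x y. 0 \<le> P x y) \<and> (\<forall>x. (\<integral>\<^sup>+ y. ennreal (P x y) \<partial>count_space UNIV) = 1)"

text \<open>The chain is driven by independent random maps: independently for every time \<open>n\<close> and
  every state \<open>y\<close>, a successor \<open>\<omega> (n, y)\<close> of \<open>y\<close> is drawn, and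
  the trajectory follows these successors. The coordinates used along a fixed trajectory are
  pairwise distinct, which makes its probability a product.\<close>

lemma markov_law_exists:
  fixes P :: "'v::countable \<Rightarrow> 'v \<Rightarrow> real"
  assumes "stochastic P"
  shows "\<exists>M. is_markov_law P x M"
proof -
  define K where "K y = embed_pmf (P y)" for y
  have pmf_K: "pmf (K y) z = P y z" for y z
    unfolding K_def using assms by (intro pmf_embed_pmf) (auto simp: stochastic_def)
  define L where "L = (\<lambda>i :: nat \<times> 'v. measure_pmf (K (snd i)))"
  interpret product_prob_space L UNIV
    unfolding L_def by (intro product_prob_spaceI measure_pmf.prob_space_axioms)
  let ?\<Omega> = "PiM UNIV L"
  define X where "X \<omega> = rec_nat x (\<lambda>n y. \<omega> (n, y))" for \<omega> :: "nat \<times> 'v \<Rightarrow> 'v"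
  have X_simps: "X \<omega> 0 = x" "X \<omega> (Suc n) = \<omega> (n, X \<omega> n)" for \<omega> n
    by (simp_all add: X_def)
  have space_\<Omega>: "space ?\<Omega> = UNIV"
    by (auto simp: space_PiM L_def PiE_def)
  have coord: "(\<lambda>\<omega>. \<omega> i) \<in> measurable ?\<Omega> (count_space UNIV)" for i
  proof -
    have "(\<lambda>\<omega>. \<omega> i) \<in> measurable ?\<Omega> (L i)"
      by (rule measurable_component_singleton) simp
    then show ?thesis
      by (simp add: L_def)
  qed
  have meas_X: "(\<lambda>\<omega>. X \<omega> n) \<in> measurable ?\<Omega> (count_space UNIV)" for n
  proof (induction n)
    case 0
    then show ?case by (simp add: X_simps)
  next
    case (Suc n)
    \<comment> \<open>The coordinate read at time \<open>n\<close> sits at a random position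
      \<open>X \<omega> n\<close>; measurability survives because this position ranges over a
      countable type.\<close>
    show ?case
      unfolding X_simps
      by (rule measurable_compose_countable[where f = "\<lambda>y \<omega>. \<omega> (n, y)" and g = "\<lambda>\<omega>. X \<omega> n"])
        (auto intro: coord Suc)
  qed
  have meas: "X \<in> measurable ?\<Omega> (Pi\<^sub>M UNIV (\<lambda>_. count_space UNIV))"
    using measurable_PiM_single'[of UNIV "\<lambda>n \<omega>. X \<omega> n" ?\<Omega> "\<lambda>_. count_space UNIV"] meas_X
    by auto
  have space_prod: "space (Pi\<^sub>M UNIV (\<lambda>_. count_space UNIV)) = (UNIV :: (nat \<Rightarrow> 'v) set)"
    by (auto simp: space_PiM PiE_def)
  define M where "M = distr ?\<Omega> (Pi\<^sub>M UNIV (\<lambda>_. count_space UNIV)) X"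
  have space_M: "space M = UNIV"
    by (auto simp: M_def space_PiM PiE_def)
  have "prob_space M"
    unfolding M_def by (rule P.prob_space_distr) (rule meas)
  moreover have "measure M {\<omega> \<in> space M. \<forall>i\<le>n. \<omega> i = v i} =
        (if v 0 = x then \<Prod>i<n. P (v i) (v (Suc i)) else 0)" for n v
  proof -
    have sets: "{\<omega>. \<forall>i\<le>n. \<omega> i = v i} \<in> sets (Pi\<^sub>M UNIV (\<lambda>_. count_space UNIV))"
    proof -
      have "{\<omega> \<in> space (Pi\<^sub>M UNIV (\<lambda>_. count_space UNIV)). \<forall>i\<le>n. \<omega> i = v i}
          \<in> sets (Pi\<^sub>M UNIV (\<lambda>_. count_space UNIV))"
        by measurable
      then show ?thesis by (simp add: space_PiM PiE_def)
    qed
    have "measure M {\<omega> \<in> space M. \<forall>i\<le>n. \<omega> i = v i} = measure ?\<Omega> {\<omega>. \<forall>i\<le>n. X \<omega> i = v i}"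
      unfolding space_M M_def using sets
      by (subst measure_distr[OF meas]) (auto simp: space_\<Omega> space_prod vimage_def)
    also have "\<dots> = (if v 0 = x then \<Prod>i<n. P (v i) (v (Suc i)) else 0)"
    proof (cases "v 0 = x")
      case False
      then have "{\<omega>. \<forall>i\<le>n. X \<omega> i = v i} = {}"
        using X_simps(1) by (metis (mono_tags, lifting) Collect_empty_eq le0)
      then show ?thesis using False by (simp only:) simp
    next
      case True
      define J where "J = (\<lambda>i. (i, v i)) ` {..<n}"
      \<comment> \<open>Following \<open>v\<close> up to time \<open>m\<close> is a condition on the
        fixed coordinates \<open>(i, v i)\<close> alone, although \<open>X\<close> reads its
        coordinates at random positions.\<close>
      have eq: "(\<forall>i\<le>m. X \<omega> i = v i) \<longleftrightarrow> (\<forall>i<m. \<omega> (i, v i) = v (Suc i))" for \<omega> m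
      proof (induction m)
        case 0
        then show ?case using True by (simp add: X_simps)
      next
        case (Suc m)
        then show ?case
          by (metis X_simps(2) le_Suc_eq less_Suc_eq order_refl)
      qed
      have "{\<omega>. \<forall>i\<le>n. X \<omega> i = v i} = emb UNIV J (Pi\<^sub>E J (\<lambda>i. {v (Suc (fst i))}))"
        by (auto simp: eq prod_emb_def J_def L_def PiE_iff)
      then have "measure ?\<Omega> {\<omega>. \<forall>i\<le>n. X \<omega> i = v i} = (\<Prod>i\<in>J. measure (L i) {v (Suc (fst i))})"
        by (simp only:) (rule measure_PiM_emb, auto simp: J_def L_def)
      also have "\<dots> = (\<Prod>i<n. P (v i) (v (Suc i)))"
        unfolding J_def by (subst prod.reindex) (auto simp: inj_on_def L_def measure_pmf_single pmf_K)
      finally show ?thesis using True by simp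
    qed
    finally show ?thesis .
  qed
  ultimately have "is_markov_law P x M"
    unfolding is_markov_law_def by (auto simp: M_def)
  then show ?thesis ..
qed

section \<open>One-step transitions and superharmonic functions of a Markov chain\<close>

locale markov_chain =
  fixes P :: "'v::countable \<Rightarrow> 'v \<Rightarrow> real" and x :: 'v and M :: "(nat \<Rightarrow> 'v) measure"
  assumes stochastic: "stochastic P" and law: "is_markov_law P x M"
begin

sublocale prob_space M
  using law by (simp add: is_markov_law_def)

lemma P_nonneg [simp]: "0 \<le> P y z"
  using stochastic by (simp add: stochastic_def)

lemma sets_M [measurable_cong]: "sets M = sets (Pi\<^sub>M UNIV (\<lambda>_. count_space UNIV))"
  using law by (simp add: is_markov_law_def)

lemma space_M [simp]: "space M = UNIV"
  using sets_eq_imp_space_eq[OF sets_M] by (simp add: space_PiM PiE_def)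

lemma measurable_coord [measurable]: "(\<lambda>\<omega>. \<omega> n) \<in> measurable M (count_space UNIV)"
  by measurable

lemma sets_Collect_M: "Measurable.pred M Q \<Longrightarrow> {\<omega>. Q \<omega>} \<in> sets M"
  using measurable_sets[of Q M "count_space UNIV" "{True}"]
  by (simp add: vimage_def)

lemma emeasure_cylinder:
  "emeasure M {\<omega>. \<forall>i\<le>n. \<omega> i = v i} =
     (if v 0 = x then \<Prod>i<n. ennreal (P (v i) (v (Suc i))) else 0)"
  using law by (auto simp: is_markov_law_def emeasure_eq_measure prod_ennreal)

text \<open>The past before time \<open>n\<close> is a list of states, so there are only countably
  many pasts. For each of them both events are cylinders, or empty, and their masses differ by the
  factor \<open>P y z\<close>.\<close>

lemma emeasure_step:
  "emeasure M {\<omega>. \<omega> n = y \<and> \<omega> (Suc n) = z} = emeasure M {\<omega>. \<omega> n = y} * ennreal (P y z)"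
proof -
  define B where "B l = {\<omega>. map \<omega> [0..<n] = l \<and> \<omega> n = y}" for l
  define C where "C l = {\<omega>. map \<omega> [0..<n] = l \<and> \<omega> n = y \<and> \<omega> (Suc n) = z}" for l
  have map_eq: "map \<omega> [0..<n] = l \<longleftrightarrow> length l = n \<and> (\<forall>i<n. \<omega> i = l ! i)" for \<omega> :: "nat \<Rightarrow> 'v" and l
    by (auto simp: list_eq_iff_nth_eq)
  have sets_BC: "B l \<in> sets M" "C l \<in> sets M" for l
  proof -
    have coord_eq: "Measurable.pred M (\<lambda>\<omega>. \<omega> i = a)" for i a
      by measurable
    show "B l \<in> sets M" "C l \<in> sets M"
      unfolding B_def C_def map_eq
      by (rule sets_Collect_M,
          auto intro!: pred_intros_logic pred_intros_countable coord_eq)+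
  qed
  have BC: "emeasure M (C l) = emeasure M (B l) * ennreal (P y z)" for l
  proof (cases "length l = n")
    case False
    then show ?thesis by (auto simp: B_def C_def map_eq)
  next
    case True
    \<comment> \<open>One path describes both cylinders: \<open>B l\<close> prescribes it up to time
      \<open>n\<close>, \<open>C l\<close> up to \<open>Suc n\<close>.\<close>
    define v where "v i = (if i < n then l ! i else if i = n then y else z)" for i
    have "B l = {\<omega>. \<forall>i\<le>n. \<omega> i = v i}"
      using True by (auto simp: B_def map_eq v_def le_less)
    moreover have "C l = {\<omega>. \<forall>i\<le>Suc n. \<omega> i = v i}"
    proof -
      have "(\<forall>i\<le>Suc n. \<omega> i = v i) \<longleftrightarrow> (\<forall>i<n. \<omega> i = l ! i) \<and> \<omega> n = y \<and> \<omega> (Suc n) = z" for \<omega>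
        unfolding v_def
        by (metis le_Suc_eq le_less less_Suc_eq less_irrefl n_not_Suc_n not_less_eq)
      then show ?thesis using True by (simp add: C_def map_eq)
    qed
    ultimately show ?thesis
      by (simp add: emeasure_cylinder) (simp add: v_def)
  qed
  have "{\<omega>. \<omega> n = y \<and> \<omega> (Suc n) = z} = (\<Union>l. C l)"
    by (auto simp: C_def)
  also have "emeasure M \<dots> = (\<integral>\<^sup>+ l. emeasure M (C l) \<partial>count_space UNIV)"
    by (rule emeasure_UN_countable) (use sets_BC in \<open>auto simp: disjoint_family_on_def C_def\<close>)
  also have "\<dots> = (\<integral>\<^sup>+ l. emeasure M (B l) \<partial>count_space UNIV) * ennreal (P y z)"
    by (simp add: BC nn_integral_multc)
  also have "(\<integral>\<^sup>+ l. emeasure M (B l) \<partial>count_space UNIV) = emeasure M (\<Union>l. B l)"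
    by (rule emeasure_UN_countable[symmetric]) (use sets_BC in \<open>auto simp: disjoint_family_on_def B_def\<close>)
  also have "(\<Union>l. B l) = {\<omega>. \<omega> n = y}"
    by (auto simp: B_def)
  finally show ?thesis .
qed

lemma emeasure_step_sum:
  "emeasure M {\<omega>. \<omega> (Suc n) = z} =
     (\<integral>\<^sup>+ y. emeasure M {\<omega>. \<omega> n = y} * ennreal (P y z) \<partial>count_space UNIV)"
proof -
  have "{\<omega>. \<omega> (Suc n) = z} = (\<Union>y. {\<omega>. \<omega> n = y \<and> \<omega> (Suc n) = z})"
    by auto
  also have "emeasure M \<dots> =
      (\<integral>\<^sup>+ y. emeasure M {\<omega>. \<omega> n = y \<and> \<omega> (Suc n) = z} \<partial>count_space UNIV)"
    by (rule emeasure_UN_countable) (auto simp: disjoint_family_on_def intro!: sets_Collect_M)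
  finally show ?thesis
    by (simp add: emeasure_step)
qed

lemma nn_integral_coord:
  fixes g :: "'v \<Rightarrow> ennreal"
  shows "(\<integral>\<^sup>+ \<omega>. g (\<omega> n) \<partial>M) = (\<integral>\<^sup>+ y. g y * emeasure M {\<omega>. \<omega> n = y} \<partial>count_space UNIV)"
proof -
  have [measurable]: "{\<omega>. \<omega> n = y} \<in> sets M" for y
    by (rule sets_Collect_M) measurable
  have "g (\<omega> n) = (\<integral>\<^sup>+ y. g y * indicator {\<omega>. \<omega> n = y} \<omega> \<partial>count_space UNIV)" for \<omega>
  proof -
    have "(\<integral>\<^sup>+ y. g y * indicator {\<omega>. \<omega> n = y} \<omega> \<partial>count_space UNIV) =
        (\<integral>\<^sup>+ y. g y * indicator {\<omega> n} y \<partial>count_space UNIV)"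
      by (intro nn_integral_cong) (auto simp: indicator_def)
    then show ?thesis
      by (simp add: nn_integral_count_space_indicator[symmetric] one_ennreal_def[symmetric])
  qed
  then have "(\<integral>\<^sup>+ \<omega>. g (\<omega> n) \<partial>M) =
      (\<integral>\<^sup>+ \<omega>. \<integral>\<^sup>+ y. g y * indicator {\<omega>. \<omega> n = y} \<omega> \<partial>count_space UNIV \<partial>M)"
    by simp
  also have "\<dots> = (\<integral>\<^sup>+ y. \<integral>\<^sup>+ \<omega>. g y * indicator {\<omega>. \<omega> n = y} \<omega> \<partial>M \<partial>count_space UNIV)"
    by (rule nn_integral_count_space_nn_integral) auto
  finally show ?thesis
    by (simp add: nn_integral_cmult_indicator)
qed

text \<open>The Markov property in integrated form, obtained by exchanging two countable sums; it
  turns superharmonicity into decrease of expectations along the chain.\<close>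

lemma nn_integral_step:
  fixes g :: "'v \<Rightarrow> ennreal"
  shows "(\<integral>\<^sup>+ \<omega>. g (\<omega> (Suc n)) \<partial>M) =
    (\<integral>\<^sup>+ \<omega>. (\<integral>\<^sup>+ z. ennreal (P (\<omega> n) z) * g z \<partial>count_space UNIV) \<partial>M)"
proof -
  have "(\<integral>\<^sup>+ \<omega>. g (\<omega> (Suc n)) \<partial>M) =
      (\<integral>\<^sup>+ z. \<integral>\<^sup>+ y. g z * (emeasure M {\<omega>. \<omega> n = y} * ennreal (P y z))
         \<partial>count_space UNIV \<partial>count_space UNIV)"
    by (simp add: nn_integral_coord emeasure_step_sum nn_integral_cmult)
  also have "\<dots> = (\<integral>\<^sup>+ y. \<integral>\<^sup>+ z. g z * (emeasure M {\<omega>. \<omega> n = y} * ennreal (P y z))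
         \<partial>count_space UNIV \<partial>count_space UNIV)"
    by (rule nn_integral_count_space_nn_integral) auto
  also have "\<dots> = (\<integral>\<^sup>+ y. (\<integral>\<^sup>+ z. ennreal (P y z) * g z \<partial>count_space UNIV) * emeasure M {\<omega>. \<omega> n = y}
         \<partial>count_space UNIV)"
    by (intro nn_integral_cong, subst nn_integral_multc[symmetric])
      (auto intro!: nn_integral_cong simp: ac_simps)
  also have "\<dots> = (\<integral>\<^sup>+ \<omega>. (\<integral>\<^sup>+ z. ennreal (P (\<omega> n) z) * g z \<partial>count_space UNIV) \<partial>M)"
    by (rule nn_integral_coord[symmetric])
  finally show ?thesis .
qed

lemma AE_initial: "AE \<omega> in M. \<omega> 0 = x"
proof -
  have "emeasure M {\<omega>. \<omega> 0 = x} = 1"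
    using emeasure_cylinder[of 0 "\<lambda>_. x"] by simp
  then show ?thesis
    by (simp add: AE_iff_emeasure_eq_1)
qed

lemma AE_P_pos: "AE \<omega> in M. \<forall>n. P (\<omega> n) (\<omega> (Suc n)) > 0"
proof -
  have "AE \<omega> in M. \<omega> n = y \<and> \<omega> (Suc n) = z \<longrightarrow> P y z > 0" for n y z
  proof (cases "P y z > 0")
    case False
    then have "P y z = 0"
      using P_nonneg[of y z] by linarith
    then have "emeasure M {\<omega>. \<omega> n = y \<and> \<omega> (Suc n) = z} = 0"
      by (simp add: emeasure_step)
    then have "AE \<omega> in M. \<not> (\<omega> n = y \<and> \<omega> (Suc n) = z)"
      by (intro AE_I[where N = "{\<omega>. \<omega> n = y \<and> \<omega> (Suc n) = z}"]) (auto intro!: sets_Collect_M)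
    then show ?thesis by (rule eventually_mono) blast
  qed simp
  then have "AE \<omega> in M. \<forall>n y z. \<omega> n = y \<and> \<omega> (Suc n) = z \<longrightarrow> P y z > 0"
    unfolding AE_all_countable by blast
  then show ?thesis by (rule eventually_mono) blast
qed

text \<open>At each step the expectation of \<open>u\<close> along the chain drops by at least
  \<open>e\<close> times the probability of being at \<open>z\<close>, and the drops telescope. For
  \<open>e = 0\<close> this says that expectations never exceed the starting value.\<close>

lemma superharmonic_sum_le:
  fixes u :: "'v \<Rightarrow> ennreal"
  assumes "\<And>y. (\<integral>\<^sup>+ w. ennreal (P y w) * u w \<partial>count_space UNIV) + e * indicator {z} y \<le> u y"
  shows "(\<Sum>n<m. e * emeasure M {\<omega>. \<omega> n = z}) + (\<integral>\<^sup>+ \<omega>. u (\<omega> m) \<partial>M) \<le> u x"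
proof (induction m)
  case 0
  have "(\<integral>\<^sup>+ \<omega>. u (\<omega> 0) \<partial>M) = (\<integral>\<^sup>+ \<omega>. u x \<partial>M)"
    using AE_initial by (intro nn_integral_cong_AE) auto
  then show ?case
    by (simp add: emeasure_space_1[unfolded space_M])
next
  case (Suc m)
  have [measurable]: "{\<omega>. \<omega> m = z} \<in> sets M"
    by (rule sets_Collect_M) measurable
  have "e * emeasure M {\<omega>. \<omega> m = z} + (\<integral>\<^sup>+ \<omega>. u (\<omega> (Suc m)) \<partial>M) =
      (\<integral>\<^sup>+ \<omega>. (\<integral>\<^sup>+ w. ennreal (P (\<omega> m) w) * u w \<partial>count_space UNIV)
          + e * indicator {\<omega>. \<omega> m = z} \<omega> \<partial>M)"
    unfolding nn_integral_step
    by (subst nn_integral_add) (auto simp: nn_integral_cmult_indicator add.commute)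
  also have "\<dots> \<le> (\<integral>\<^sup>+ \<omega>. u (\<omega> m) \<partial>M)"
  proof (rule nn_integral_mono)
    fix \<omega>
    show "(\<integral>\<^sup>+ w. ennreal (P (\<omega> m) w) * u w \<partial>count_space UNIV)
          + e * indicator {\<omega>. \<omega> m = z} \<omega> \<le> u (\<omega> m)"
      using assms[of "\<omega> m"] by (simp add: indicator_def)
  qed
  finally have "(\<Sum>n<m. e * emeasure M {\<omega>. \<omega> n = z}) +
      (e * emeasure M {\<omega>. \<omega> m = z} + (\<integral>\<^sup>+ \<omega>. u (\<omega> (Suc m)) \<partial>M)) \<le>
      (\<Sum>n<m. e * emeasure M {\<omega>. \<omega> n = z}) + (\<integral>\<^sup>+ \<omega>. u (\<omega> m) \<partial>M)"
    by (rule add_left_mono)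
  from order_trans[OF this Suc] show ?case
    by (simp add: add.assoc)
qed

text \<open>A superharmonic function that is strictly superharmonic at \<open>z\<close> bounds the expected number
  of visits to \<open>z\<close>.\<close>

lemma AE_eventually_leaves:
  fixes u :: "'v \<Rightarrow> real" and e :: real
  assumes "\<And>y. 0 \<le> u y" and "e > 0"
    and super: "\<And>y. (\<integral>\<^sup>+ w. ennreal (P y w) * ennreal (u w) \<partial>count_space UNIV)
        + ennreal e * indicator {z} y \<le> ennreal (u y)"
  shows "AE \<omega> in M. \<forall>\<^sub>F n in sequentially. \<omega> n \<noteq> z"
proof -
  define p where "p n = measure M {\<omega>. \<omega> n = z}" for n
  have "(\<Sum>n<m. p n) \<le> u x / e" for m
  proof -
    have "ennreal (e * (\<Sum>n<m. p n)) = (\<Sum>n<m. ennreal e * emeasure M {\<omega>. \<omega> n = z})"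
      using assms(2)
      by (simp add: p_def emeasure_eq_measure sum_distrib_left[symmetric] ennreal_mult sum_nonneg)
    also have "\<dots> \<le> ennreal (u x)"
      using superharmonic_sum_le[OF super, of m]
      by (rule order_trans[rotated]) simp
    finally show ?thesis
      using assms(1)[of x] assms(2) by (simp add: field_simps ennreal_le_iff)
  qed
  then have "summable p"
    by (intro summableI_nonneg_bounded[where x = "u x / e"]) (auto simp: p_def)
  then have "AE \<omega> in M. \<forall>\<^sub>F n in sequentially. \<omega> \<in> space M - {\<omega>. \<omega> n = z}"
    unfolding p_def
    by (intro borel_cantelli_AE1) (auto intro!: sets_Collect_M simp: emeasure_eq_measure)
  then show ?thesis by simp
qed

text \<open>On \<open>E\<close> the limit inferior of \<open>u\<close> along the path is at least
  \<open>b\<close>; Fatou bounds its expectation by the expectations at fixed times, which stay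
  below \<open>u x\<close>.\<close>

lemma prob_le_of_superharmonic:
  fixes u :: "'v \<Rightarrow> real"
  assumes "\<And>y. 0 \<le> u y" and "b \<ge> 0"
    and super: "\<And>y. (\<integral>\<^sup>+ w. ennreal (P y w) * ennreal (u w) \<partial>count_space UNIV) \<le> ennreal (u y)"
    and E: "E \<in> sets M" and ev: "\<And>\<omega>. \<omega> \<in> E \<Longrightarrow> \<forall>\<^sub>F n in sequentially. b \<le> u (\<omega> n)"
  shows "b * measure M E \<le> u x"
proof -
  have [measurable]: "(\<lambda>\<omega>. ennreal (u (\<omega> n))) \<in> borel_measurable M" for n
    by measurable
  have "ennreal (b * measure M E) = (\<integral>\<^sup>+ \<omega>. ennreal b * indicator E \<omega> \<partial>M)"
    using E assms(2) by (simp add: nn_integral_cmult_indicator emeasure_eq_measure ennreal_mult)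
  also have "\<dots> \<le> (\<integral>\<^sup>+ \<omega>. liminf (\<lambda>n. ennreal (u (\<omega> n))) \<partial>M)"
  proof (rule nn_integral_mono)
    fix \<omega>
    show "ennreal b * indicator E \<omega> \<le> liminf (\<lambda>n. ennreal (u (\<omega> n)))"
    proof (cases "\<omega> \<in> E")
      case True
      from ev[OF this] have "\<forall>\<^sub>F n in sequentially. ennreal b \<le> ennreal (u (\<omega> n))"
        by eventually_elim (rule ennreal_leI)
      then show ?thesis
        using True by (simp add: Liminf_bounded)
    qed simp
  qed
  also have "\<dots> \<le> liminf (\<lambda>n. \<integral>\<^sup>+ \<omega>. ennreal (u (\<omega> n)) \<partial>M)"
    by (rule nn_integral_liminf) measurable
  also have "\<dots> \<le> liminf (\<lambda>n. ennreal (u x))"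
    using superharmonic_sum_le[of "\<lambda>y. ennreal (u y)" 0] super
    by (intro Liminf_mono) auto
  finally show ?thesis
    using assms(1)[of x] by (simp add: Liminf_const)
qed

end


section \<open>Walks on the spider network\<close>

instance spider :: (countable) countable
  by countable_datatype

text \<open>A finite superset of the support of row \<open>x\<close>, which turns
  \<open>infsum\<close> into a finite sum; the loop at the origin belongs to it even if its weight
  is zero. By the index shift, \<open>vtx m k\<close> is the vertex just below
  \<open>Leg m k\<close>, the origin included.\<close>

fun nbrs :: "'k::finite spider \<Rightarrow> 'k spider set" where
  "nbrs Origin = insert Origin (range (Leg 0))"
| "nbrs (Leg m k) = {Leg (Suc m) k, vtx m k}"

lemma finite_nbrs [simp]: "finite (nbrs x)"
  by (cases x) auto

lemma spider_adj_outside_nbrs: "y \<notin> nbrs x \<Longrightarrow> spider_adj \<gamma>1 \<gamma>2 \<gamma>3 x y = 0"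
proof (cases x)
  case (Leg m k)
  then show "y \<notin> nbrs x \<Longrightarrow> ?thesis"
    by (cases m; cases y) auto
qed (cases y; auto)

lemma mat_app_spider_adj:
  "mat_app (spider_adj \<gamma>1 \<gamma>2 \<gamma>3) f x = (\<Sum>y\<in>nbrs x. spider_adj \<gamma>1 \<gamma>2 \<gamma>3 x y * f y)"
proof -
  have "mat_app (spider_adj \<gamma>1 \<gamma>2 \<gamma>3) f x = (\<Sum>\<^sub>\<infinity>y\<in>nbrs x. spider_adj \<gamma>1 \<gamma>2 \<gamma>3 x y * f y)"
    unfolding mat_app_def
    by (rule infsum_cong_neutral) (auto simp: spider_adj_outside_nbrs)
  then show ?thesis by simp
qed

lemma mat_app_Origin:
  fixes \<gamma>2 :: "'k::finite \<Rightarrow> real"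
  shows "mat_app (spider_adj \<gamma>1 \<gamma>2 \<gamma>3) f Origin = \<gamma>1 * f Origin + (\<Sum>k\<in>UNIV. \<gamma>2 k * f (Leg 0 k))"
proof -
  have "Origin \<notin> range (Leg 0)" "inj (Leg 0 :: 'k \<Rightarrow> 'k spider)"
    by (auto simp: inj_def)
  then show ?thesis
    unfolding mat_app_spider_adj nbrs.simps
    by (subst sum.insert) (simp_all add: sum.reindex)
qed

lemma mat_app_Leg:
  fixes \<gamma>2 :: "'k::finite \<Rightarrow> real"
  shows "mat_app (spider_adj \<gamma>1 \<gamma>2 \<gamma>3) f (Leg m k) = \<gamma>3 * (f (Leg (Suc m) k) + f (vtx m k))"
  by (cases m) (auto simp: mat_app_spider_adj algebra_simps)

text \<open>Irreducibility as an induction rule: edges of positive weight lead from any leg vertex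
  down to the origin, and from there up every leg.\<close>

lemma spider_adj_pos_induct [consumes 3, case_names base step]:
  fixes x y :: "'k spider"
  assumes "\<And>k. \<gamma>2 k > 0" and "\<gamma>3 > 0" and "Q x"
    and step: "\<And>x y. Q x \<Longrightarrow> spider_adj \<gamma>1 \<gamma>2 \<gamma>3 x y > 0 \<Longrightarrow> Q y"
  shows "Q y"
proof -
  have down: "Q (Leg m k) \<Longrightarrow> Q Origin" for m and k :: 'k
  proof (induction m)
    case 0
    then show ?case using assms(2) by (rule_tac step) auto
  next
    case (Suc m)
    have "Q (Leg m k)"
      by (rule step[OF Suc.prems]) (use assms(2) in auto)
    then show ?case by (rule Suc.IH)
  qed
  have "Q Origin"
    using \<open>Q x\<close> down by (cases x) auto
  have "Q (Leg m k)" for m and k :: 'k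
  proof (induction m)
    case 0
    show ?case by (rule step[OF \<open>Q Origin\<close>]) (use assms(1) in auto)
  next
    case (Suc m)
    show ?case by (rule step[OF Suc.IH]) (use assms(2) in auto)
  qed
  with \<open>Q Origin\<close> show ?thesis by (cases y) auto
qed

text \<open>The increments decrease, and none is negative, since otherwise the sequence would fall
  below zero at least linearly. Hence \<open>g\<close> stays above \<open>g 0\<close>, so each
  increment loses at least \<open>(2 - c) * g 0\<close> and the increments become negative after
  all.\<close>

lemma no_positive_strictly_concave_seq:
  fixes g :: "nat \<Rightarrow> real"
  assumes pos: "\<And>n. g n > 0" and "c < 2"
    and concave: "\<And>n. g (Suc (Suc n)) + g n \<le> c * g (Suc n)"
  shows False
proof -
  define d where "d n = g (Suc n) - g n" for n
  have d_Suc: "d (Suc n) \<le> d n - (2 - c) * g (Suc n)" for n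
    using concave[of n] by (simp add: d_def algebra_simps)
  have d_dec: "d (Suc n) \<le> d n" for n
  proof -
    have "0 \<le> (2 - c) * g (Suc n)"
      using pos[of "Suc n"] assms(2) by simp
    then show ?thesis
      using d_Suc[of n] by linarith
  qed
  have d_nonneg: "d N \<ge> 0" for N
  proof (rule ccontr)
    assume "\<not> d N \<ge> 0"
    then have neg: "- d N > 0" by simp
    have d_le: "d (N + n) \<le> d N" for n
      by (induction n) (auto intro: order_trans[OF d_dec])
    have g_le: "g (N + n) \<le> g N + real n * d N" for n
    proof (induction n)
      case (Suc n)
      then show ?case using d_le[of n] by (simp add: d_def algebra_simps)
    qed simp
    obtain n where "g N < real n * - d N"
      using reals_Archimedean3[OF neg] by blast
    then show False
      using g_le[of n] pos[of "N + n"] by simp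
  qed
  have g_ge: "g 0 \<le> g n" for n
  proof (induction n)
    case (Suc n)
    then show ?case using d_nonneg[of n] by (simp add: d_def)
  qed simp
  define e where "e = (2 - c) * g 0"
  have "e > 0"
    using pos[of 0] assms(2) by (simp add: e_def)
  have d_le: "d n \<le> d 0 - real n * e" for n
  proof (induction n)
    case (Suc n)
    have "e \<le> (2 - c) * g (Suc n)"
      unfolding e_def using g_ge[of "Suc n"] assms(2) by (intro mult_left_mono) auto
    then show ?case
      using Suc d_Suc[of n] by (simp add: algebra_simps)
  qed simp
  obtain n where "d 0 < real n * e"
    using reals_Archimedean3[OF \<open>e > 0\<close>] by blast
  then show False
    using d_le[of n] d_nonneg[of n] by simp
qed

locale spider =
  fixes \<gamma>1 \<gamma>3 :: real and \<gamma>2 :: "'k::finite \<Rightarrow> real"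
  assumes \<gamma>1_nonneg: "\<gamma>1 \<ge> 0" and \<gamma>2_pos: "\<And>k. \<gamma>2 k > 0" and \<gamma>3_pos: "\<gamma>3 > 0"
    and drift_pos: "spider_drift \<gamma>1 \<gamma>2 \<gamma>3 > 0"
begin

abbreviation "\<Lambda> \<equiv> spider_drift \<gamma>1 \<gamma>2 \<gamma>3"
abbreviation "A \<equiv> spider_adj \<gamma>1 \<gamma>2 \<gamma>3"
abbreviation "\<psi> \<equiv> spider_psi \<gamma>1 \<gamma>2 \<gamma>3"
abbreviation "\<psi>mix \<equiv> spider_psi_mix \<gamma>1 \<gamma>2 \<gamma>3"

lemma sum_weights: "\<gamma>1 + (\<Sum>k\<in>UNIV. \<gamma>2 k) = 2 * \<gamma>3 - \<Lambda>"
  by (simp add: spider_drift_def)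

lemma adj_nonneg [simp]: "0 \<le> A x y"
  using \<gamma>1_nonneg \<gamma>2_pos \<gamma>3_pos
  by (cases x; cases y) (auto simp: less_imp_le)

lemma adj_pos_sym: "A x y > 0 \<Longrightarrow> A y x > 0"
  using \<gamma>2_pos \<gamma>3_pos by (cases x; cases y) (auto split: if_splits)

lemma adj_pos_induct [consumes 1]:
  assumes "Q x" and "\<And>x y. Q x \<Longrightarrow> A x y > 0 \<Longrightarrow> Q y"
  shows "Q y"
  using spider_adj_pos_induct[of \<gamma>2 \<gamma>3 Q x \<gamma>1 y] assms \<gamma>2_pos \<gamma>3_pos by blast

section \<open>Powers of the adjacency matrix and the spectral radius\<close>

lemma mat_pow_Suc: "mat_pow A (Suc n) x y = (\<Sum>z\<in>nbrs x. A x z * mat_pow A n z y)"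
  using mat_app_spider_adj[of \<gamma>1 \<gamma>2 \<gamma>3 "\<lambda>z. mat_pow A n z y" x] by (simp add: mat_app_def)

lemma mat_pow_nonneg [simp]: "0 \<le> mat_pow A n x y"
  by (induction n arbitrary: x) (auto simp: mat_pow_Suc simp del: mat_pow.simps(2) intro!: sum_nonneg)

text \<open>On the legs equality holds; at the origin the row sum falls short by exactly \<Lambda>,
  which is positive.\<close>

lemma row_sum_le: "(\<Sum>z\<in>nbrs x. A x z) \<le> 2 * \<gamma>3"
proof -
  have "(\<Sum>z\<in>nbrs x. A x z) = mat_app A (\<lambda>_. 1) x"
    by (simp add: mat_app_spider_adj)
  also have "\<dots> \<le> 2 * \<gamma>3"
    using sum_weights drift_pos by (cases x) (auto simp: mat_app_Origin mat_app_Leg)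
  finally show ?thesis .
qed

lemma mat_pow_le: "mat_pow A n x y \<le> (2 * \<gamma>3) ^ n"
proof (induction n arbitrary: x)
  case (Suc n)
  have "mat_pow A (Suc n) x y \<le> (\<Sum>z\<in>nbrs x. A x z * (2 * \<gamma>3) ^ n)"
    unfolding mat_pow_Suc by (intro sum_mono mult_left_mono Suc) simp
  also have "\<dots> \<le> 2 * \<gamma>3 * (2 * \<gamma>3) ^ n"
    unfolding sum_distrib_right[symmetric]
    using row_sum_le \<gamma>3_pos by (intro mult_right_mono) auto
  finally show ?case by simp
qed simp

lemma summable_mat_pow:
  assumes "0 < r" and "r < 1 / (2 * \<gamma>3)"
  shows "summable (\<lambda>n. mat_pow A n x y * r ^ n)"
proof (rule summable_comparison_test')
  have "2 * \<gamma>3 * r < 1"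
    using assms \<gamma>3_pos by (simp add: field_simps)
  then show "summable (\<lambda>n. (2 * \<gamma>3 * r) ^ n)"
    using assms \<gamma>3_pos by (intro summable_geometric) auto
  show "norm (mat_pow A n x y * r ^ n) \<le> (2 * \<gamma>3 * r) ^ n" if "n \<ge> 0" for n
    using mat_pow_le[of n x y] assms
    by (simp add: abs_mult power_mult_distrib mult_right_mono)
qed

text \<open>If the Green function were finite beyond \<open>1 / (2 * \<gamma>3)\<close>, it would be positive and
  strictly concave along a leg.\<close>

lemma not_summable_mat_pow:
  assumes r: "r > 1 / (2 * \<gamma>3)"
  shows "\<not> summable (\<lambda>n. mat_pow A n x y * r ^ n)"
proof
  assume "summable (\<lambda>n. mat_pow A n x y * r ^ n)"
  have "r > 0"
    using r \<gamma>3_pos by (smt (verit) divide_pos_pos)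
  \<comment> \<open>Summability spreads from \<open>x\<close> to every starting vertex, because
    along an edge from \<open>v\<close> to \<open>w\<close> the power \<open>A^(n+1)(v, y)\<close>
    dominates \<open>A v w\<close> times \<open>A^n(w, y)\<close>.\<close>
  have summable: "summable (\<lambda>n. mat_pow A n w y * r ^ n)" for w
    using \<open>summable (\<lambda>n. mat_pow A n x y * r ^ n)\<close>
  proof (induction rule: adj_pos_induct)
    case (1 v w)
    have le: "norm (A v w * r * (mat_pow A n w y * r ^ n)) \<le> mat_pow A (Suc n) v y * r ^ Suc n" for n
    proof -
      have "w \<in> nbrs v"
        using 1(2) spider_adj_outside_nbrs by force
      then have "A v w * mat_pow A n w y \<le> mat_pow A (Suc n) v y"
        unfolding mat_pow_Suc
        by (intro member_le_sum[of w "nbrs v" "\<lambda>w. A v w * mat_pow A n w y"]) auto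
      then have "(A v w * mat_pow A n w y) * r ^ Suc n \<le> mat_pow A (Suc n) v y * r ^ Suc n"
        using \<open>r > 0\<close> by (intro mult_right_mono) auto
      then show ?thesis
        using \<open>r > 0\<close> by (simp add: abs_mult ac_simps del: mat_pow.simps(2))
    qed
    have "summable (\<lambda>n. mat_pow A (Suc n) v y * r ^ Suc n)"
      using 1(1) by (subst summable_Suc_iff)
    then have "summable (\<lambda>n. A v w * r * (mat_pow A n w y * r ^ n))"
      by (rule summable_comparison_test'[where N = 0]) (rule le)
    then show ?case
      using 1(2) \<open>r > 0\<close> by (simp add: summable_cmult_iff)
  qed
  define f where "f w = (\<Sum>n. mat_pow A n w y * r ^ n)" for w
  have f_nonneg: "f w \<ge> 0" for w
    unfolding f_def using \<open>r > 0\<close> by (intro suminf_nonneg summable) simp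
  \<comment> \<open>The resolvent equation for the Green function \<open>f\<close>: the term for
    \<open>n = 0\<close> is the indicator of \<open>y\<close>, and shifting the index in the rest
    gives \<open>r\<close> times \<open>A\<close> applied to \<open>f\<close>.\<close>
  have f_eq: "f w = (if w = y then 1 else 0) + r * mat_app A f w" for w
  proof -
    have "r * mat_app A f w = (\<Sum>z\<in>nbrs w. r * A w z * (\<Sum>n. mat_pow A n z y * r ^ n))"
      by (simp add: mat_app_spider_adj sum_distrib_left f_def ac_simps)
    also have "\<dots> = (\<Sum>z\<in>nbrs w. \<Sum>n. r * A w z * (mat_pow A n z y * r ^ n))"
      by (simp add: suminf_mult summable)
    also have "\<dots> = (\<Sum>n. \<Sum>z\<in>nbrs w. r * A w z * (mat_pow A n z y * r ^ n))"
      by (intro suminf_sum[symmetric] summable_mult summable)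
    also have "\<dots> = (\<Sum>n. mat_pow A (Suc n) w y * r ^ Suc n)"
      unfolding mat_pow_Suc by (simp add: sum_distrib_left sum_distrib_right ac_simps)
    also have "\<dots> = f w - (if w = y then 1 else 0)"
      unfolding f_def by (subst suminf_split_head[OF summable]) simp
    finally show ?thesis by simp
  qed
  have f_app_nonneg: "mat_app A f w \<ge> 0" for w
    unfolding mat_app_spider_adj by (intro sum_nonneg) (simp add: f_nonneg)
  \<comment> \<open>\<open>f y\<close> is at least \<open>1\<close>. Positivity of \<open>f\<close>
    travels against the edges, which is the direction of the induction because
    \<open>adj_pos_sym\<close> allows every edge to be reversed.\<close>
  have f_pos: "f w > 0" for w
  proof -
    have "f y > 0"
      using f_eq[of y] f_app_nonneg[of y] \<open>r > 0\<close> by (simp add: add_pos_nonneg)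
    then show ?thesis
    proof (induction rule: adj_pos_induct)
      case (1 v w)
      have "A w v > 0"
        using 1(2) by (rule adj_pos_sym)
      then have "v \<in> nbrs w"
        using spider_adj_outside_nbrs by force
      then have "A w v * f v \<le> mat_app A f w"
        unfolding mat_app_spider_adj
        by (intro member_le_sum[of v "nbrs w" "\<lambda>v. A w v * f v"]) (auto simp: f_nonneg)
      moreover have "A w v * f v > 0"
        using \<open>A w v > 0\<close> 1(1) by simp
      ultimately have "r * mat_app A f w > 0"
        using \<open>r > 0\<close> by simp
      then show ?case
        using f_eq[of w] by (smt (verit))
    qed
  qed
  fix k :: 'k
  show False
  \<comment> \<open>Dropping the indicator from the resolvent equation leaves
    \<open>r * mat_app A f w \<le> f w\<close>. At levels from \<open>1\<close> on this is the
    concavity inequality, and the bound on \<open>r\<close> makes its constant smaller than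
    \<open>2\<close>.\<close>
  proof (rule no_positive_strictly_concave_seq[of "\<lambda>n. f (vtx n k)" "1 / (r * \<gamma>3)"])
    show "1 / (r * \<gamma>3) < 2"
      using r \<gamma>3_pos \<open>r > 0\<close> by (simp add: field_simps)
    fix n
    have "r * mat_app A f (Leg n k) \<le> f (Leg n k)"
      using f_eq[of "Leg n k"] by simp
    then show "f (vtx (Suc (Suc n)) k) + f (vtx n k) \<le> 1 / (r * \<gamma>3) * f (vtx (Suc n) k)"
      using \<gamma>3_pos \<open>r > 0\<close> by (simp add: mat_app_Leg field_simps)
  qed (rule f_pos)
qed

text \<open>The equivalence pins down the existentially quantified \<rho> in
  \<open>is_merw\<close>.\<close>

lemma comb_spectral_radius: "is_comb_spectral_radius A \<rho> \<longleftrightarrow> \<rho> = 2 * \<gamma>3"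
proof -
  have "spectral_radius_at A x y = ereal (2 * \<gamma>3)" for x y
  proof -
    have "conv_radius (\<lambda>n. mat_pow A n x y) = ereal (1 / (2 * \<gamma>3))"
    proof (rule antisym)
      show "conv_radius (\<lambda>n. mat_pow A n x y) \<le> ereal (1 / (2 * \<gamma>3))"
      proof (rule conv_radius_leI_ex)
        fix r :: real assume r: "0 < r" "ereal r > ereal (1 / (2 * \<gamma>3))"
        then have "\<not> summable (\<lambda>n. norm (mat_pow A n x y * r ^ n))"
          using not_summable_mat_pow[of r x y] summable_norm_cancel by force
        then show "\<exists>z. norm z = r \<and> \<not> summable (\<lambda>n. norm (mat_pow A n x y * z ^ n))"
          using r(1) by (intro exI[of _ r]) auto
      qed (use \<gamma>3_pos in auto)
      show "ereal (1 / (2 * \<gamma>3)) \<le> conv_radius (\<lambda>n. mat_pow A n x y)"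
      proof (rule conv_radius_geI_ex)
        fix r :: real assume "0 < r" "ereal r < ereal (1 / (2 * \<gamma>3))"
        then show "\<exists>z. norm z = r \<and> summable (\<lambda>n. mat_pow A n x y * z ^ n)"
          using summable_mat_pow[of r x y] by (intro exI[of _ r]) auto
      qed
    qed
    then show ?thesis
      using \<gamma>3_pos by (simp add: spectral_radius_at_def)
  qed
  then show ?thesis
    by (auto simp: is_comb_spectral_radius_def)
qed

section \<open>Positive eigenfunctions and their classification\<close>

lemma \<psi>_vtx: "\<psi> i (vtx n k) = 1 + (if i = k then 1 else 0) * (\<Lambda> / \<gamma>2 k) * real n"
  by (cases n) auto

lemma \<psi>mix_vtx: "\<psi>mix \<mu> (vtx n k) = 1 + pmf \<mu> k * (\<Lambda> / \<gamma>2 k) * real n"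
proof -
  have "\<psi>mix \<mu> (vtx n k) =
      (\<Sum>i\<in>UNIV. pmf \<mu> i + (if i = k then pmf \<mu> i * (\<Lambda> / \<gamma>2 k) * real n else 0))"
    unfolding spider_psi_mix_def \<psi>_vtx by (intro sum.cong) (auto simp: algebra_simps)
  also have "\<dots> = (\<Sum>i\<in>UNIV. pmf \<mu> i) + pmf \<mu> k * (\<Lambda> / \<gamma>2 k) * real n"
    by (simp add: sum.distrib)
  finally show ?thesis
    by (simp add: sum_pmf_eq_1)
qed

text \<open>Affine functions satisfy the equation on the legs. At the origin the slopes, weighted by
  \<open>\<gamma>2\<close>, add up to \<Lambda>, which is exactly what the row sum lacks. Both the
  \<open>\<psi> i\<close> (with \<open>c\<close> an indicator) and the mixtures (with
  \<open>c\<close> the weights) are covered.\<close>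

lemma mat_app_affine:
  assumes f: "\<And>n k. f (vtx n k) = 1 + c k * (\<Lambda> / \<gamma>2 k) * real n" and c: "(\<Sum>k\<in>UNIV. c k) = 1"
  shows "mat_app A f x = 2 * \<gamma>3 * f x"
proof (cases x)
  case Origin
  have f0: "f Origin = 1"
    using f[of 0] by simp
  have "\<gamma>2 k * f (Leg 0 k) = \<gamma>2 k + c k * \<Lambda>" for k
    using f[of 1 k] \<gamma>2_pos[of k] by (simp add: field_simps)
  then have "mat_app A f Origin = \<gamma>1 + ((\<Sum>k\<in>UNIV. \<gamma>2 k) + (\<Sum>k\<in>UNIV. c k) * \<Lambda>)"
    by (simp add: mat_app_Origin f0 sum.distrib sum_distrib_right)
  then show ?thesis
    using c sum_weights Origin f0 by simp
next
  case (Leg m k)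
  then show ?thesis
    using f[of m k] f[of "Suc m" k] f[of "Suc (Suc m)" k]
    by (simp add: mat_app_Leg algebra_simps add_divide_distrib)
qed

lemma pos_eigenfunction_affine:
  assumes f: "\<And>n k. f (vtx n k) = 1 + c k * (\<Lambda> / \<gamma>2 k) * real n"
    and c: "(\<Sum>k\<in>UNIV. c k) = 1" "\<And>k. c k \<ge> 0"
  shows "pos_eigenfunction A (2 * \<gamma>3) f"
proof -
  have "f x > 0" for x
  proof -
    obtain n k where x: "x = vtx n k"
      using vtx_cases[of x] by blast
    show ?thesis
      unfolding x f using c(2)[of k] \<gamma>2_pos[of k] drift_pos
      by (intro add_pos_nonneg mult_nonneg_nonneg) (auto simp: less_imp_le)
  qed
  then show ?thesis
    unfolding pos_eigenfunction_def using mat_app_affine[OF f c(1)] by blast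
qed

lemma pos_eigenfunction_\<psi>: "pos_eigenfunction A (2 * \<gamma>3) (\<psi> i)"
  by (rule pos_eigenfunction_affine[OF \<psi>_vtx]) auto

lemma pos_eigenfunction_\<psi>mix: "pos_eigenfunction A (2 * \<gamma>3) (\<psi>mix \<mu>)"
  by (rule pos_eigenfunction_affine[OF \<psi>mix_vtx]) (auto simp: sum_pmf_eq_1)

lemma \<psi>mix_pos: "\<psi>mix \<mu> x > 0"
  using pos_eigenfunction_\<psi>mix by (auto simp: pos_eigenfunction_def)

text \<open>All \<open>\<psi> i\<close> take the value \<open>1\<close> at the origin, so the
  coefficients sum to zero; at the first vertex of leg \<open>k\<close> only \<open>\<psi> k\<close>
  has an additional term, which isolates \<open>c k\<close>.\<close>

lemma \<psi>_independent:
  assumes "\<And>x. (\<Sum>i\<in>UNIV. c i * \<psi> i x) = 0"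
  shows "c k = 0"
proof -
  have "(\<Sum>i\<in>UNIV. c i * \<psi> i (Leg 0 k)) =
      (\<Sum>i\<in>UNIV. c i * \<psi> i Origin + (if i = k then c i * (\<Lambda> / \<gamma>2 k) else 0))"
    by (intro sum.cong) (auto simp: algebra_simps)
  also have "\<dots> = c k * (\<Lambda> / \<gamma>2 k)"
    using assms[of Origin] by (simp add: sum.distrib)
  finally show ?thesis
    using assms[of "Leg 0 k"] \<gamma>2_pos[of k] drift_pos by simp
qed

lemma pos_eigenfunction_cases:
  assumes "pos_eigenfunction A (2 * \<gamma>3) \<phi>"
  obtains \<mu> where "\<And>x. \<phi> x = \<phi> Origin * \<psi>mix \<mu> x"
proof -
  define a where "a = \<phi> Origin"
  define b where "b k = \<phi> (Leg 0 k) - a" for k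
  have pos: "\<phi> x > 0" and eigen: "mat_app A \<phi> x = 2 * \<gamma>3 * \<phi> x" for x
    using assms by (auto simp: pos_eigenfunction_def)
  have "a > 0" by (simp add: a_def pos)
  have \<phi>_Suc: "\<phi> (vtx (Suc (Suc n)) k) = 2 * \<phi> (vtx (Suc n) k) - \<phi> (vtx n k)" for n k
    using eigen[of "Leg n k"] \<gamma>3_pos by (simp add: mat_app_Leg)
  have \<phi>: "\<phi> (vtx n k) = a + b k * real n" for n k
  proof (induction n rule: induct_nat_012)
    case (ge2 n)
    then show ?case
      unfolding \<phi>_Suc by (simp add: algebra_simps)
  qed (simp_all add: a_def b_def)
  have b_nonneg: "b k \<ge> 0" for k
  proof (rule ccontr)
    assume "\<not> b k \<ge> 0"
    then obtain n where "a < real n * - b k"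
      using reals_Archimedean3[of "- b k"] by auto
    then show False
      using pos[of "vtx n k"] by (simp add: \<phi> algebra_simps)
  qed
  have "\<gamma>1 * a + (\<Sum>k\<in>UNIV. \<gamma>2 k * (a + b k)) = 2 * \<gamma>3 * a"
    using eigen[of Origin] by (simp add: mat_app_Origin b_def a_def)
  then have sum_b: "(\<Sum>k\<in>UNIV. \<gamma>2 k * b k) = \<Lambda> * a"
    by (simp add: spider_drift_def algebra_simps sum.distrib sum_distrib_left)
  \<comment> \<open>Comparing slopes forces \<open>m\<close>: the function
    \<open>a * \<psi>mix\<close> has slope \<open>a * m k * \<Lambda> / \<gamma>2 k\<close> on leg
    \<open>k\<close>, which must equal \<open>b k\<close>. The equation at the origin,
    \<open>sum_b\<close>, is then the normalisation of \<open>m\<close>.\<close>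
  define m where "m k = \<gamma>2 k * b k / (\<Lambda> * a)" for k
  have m_nonneg: "m k \<ge> 0" for k
    using b_nonneg[of k] \<gamma>2_pos[of k] drift_pos \<open>a > 0\<close> by (simp add: m_def)
  have "(\<Sum>k\<in>UNIV. m k) = 1"
    using sum_b drift_pos \<open>a > 0\<close> by (simp add: m_def sum_divide_distrib[symmetric])
  then have "(\<integral>\<^sup>+ k. ennreal (m k) \<partial>count_space UNIV) = 1"
    by (simp add: nn_integral_count_space_finite m_nonneg)
  then have pmf_m: "pmf (embed_pmf m) k = m k" for k
    using m_nonneg by (intro pmf_embed_pmf) auto
  have "\<phi> x = \<phi> Origin * \<psi>mix (embed_pmf m) x" for x
  proof -
    obtain n k where x: "x = vtx n k"
      using vtx_cases[of x] by blast
    show ?thesis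
      unfolding x \<psi>mix_vtx \<phi> pmf_m a_def[symmetric]
      using \<gamma>2_pos[of k] drift_pos \<open>a > 0\<close> by (simp add: m_def field_simps)
  qed
  then show ?thesis by (rule that)
qed

section \<open>The kernels and their correspondence with probability distributions\<close>

definition merw :: "'k pmf \<Rightarrow> 'k spider \<Rightarrow> 'k spider \<Rightarrow> real" where
  "merw \<mu> = merw_kernel A (2 * \<gamma>3) (\<psi>mix \<mu>)"

lemma merw_Origin_Origin: "merw \<mu> Origin Origin = \<gamma>1 / (2 * \<gamma>3)"
  using \<psi>mix_vtx[of \<mu> 0] by (simp add: merw_def merw_kernel_def)

lemma merw_Origin_Leg: "merw \<mu> Origin (vtx 1 k) = (\<gamma>2 k + pmf \<mu> k * \<Lambda>) / (2 * \<gamma>3)"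
  using \<psi>mix_vtx[of \<mu> 0] \<psi>mix_vtx[of \<mu> 1 k] \<gamma>2_pos[of k]
  by (simp add: merw_def merw_kernel_def field_simps)

lemma merw_vtx:
  assumes "n \<ge> 1" and "m = n + 1 \<or> m = n - 1"
  shows "merw \<mu> (vtx n k) (vtx m k) =
    1 / 2 * ((\<gamma>2 k + pmf \<mu> k * \<Lambda> * real m) / (\<gamma>2 k + pmf \<mu> k * \<Lambda> * real n))"
proof -
  have \<psi>: "\<psi>mix \<mu> (vtx j k) = (\<gamma>2 k + pmf \<mu> k * \<Lambda> * real j) / \<gamma>2 k" for j
    using \<gamma>2_pos[of k] by (simp add: \<psi>mix_vtx field_simps)
  have "A (vtx n k) (vtx m k) = \<gamma>3"
    using assms(2) by (auto simp: spider_adj_vtx[OF assms(1)])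
  \<comment> \<open>The case \<open>b = 0\<close> holds because division by zero gives zero on both
    sides.\<close>
  moreover have "\<gamma>3 * (a / \<gamma>2 k / (2 * \<gamma>3 * (b / \<gamma>2 k))) = 1 / 2 * (a / b)" for a b :: real
    using \<gamma>2_pos[of k] \<gamma>3_pos by (cases "b = 0") (auto simp: divide_simps)
  ultimately show ?thesis
    unfolding merw_def merw_kernel_def \<psi> by simp
qed

text \<open>The probability of stepping from the origin into leg \<open>k\<close> is affine in
  \<open>pmf \<mu> k\<close> with nonzero slope, so the kernel determines \<mu>. Conversely a kernel
  involves only ratios of its eigenfunction, so the factor \<open>\<phi> Origin\<close> in the
  classification cancels.\<close>

lemma bij_betw_merw: "bij_betw merw UNIV {Q. is_merw A Q}"
proof -
  have "inj merw"
  proof (rule injI)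
    fix \<mu> \<nu> :: "'k pmf" assume "merw \<mu> = merw \<nu>"
    then have "pmf \<mu> k = pmf \<nu> k" for k
      using merw_Origin_Leg[of \<mu> k] merw_Origin_Leg[of \<nu> k] \<gamma>3_pos drift_pos by simp
    then show "\<mu> = \<nu>" by (rule pmf_eqI)
  qed
  moreover have "range merw = {Q. is_merw A Q}"
  proof safe
    fix \<mu>
    show "is_merw A (merw \<mu>)"
      unfolding is_merw_def merw_def
      using comb_spectral_radius pos_eigenfunction_\<psi>mix by blast
  next
    fix Q assume "is_merw A Q"
    then obtain \<phi> where \<phi>: "pos_eigenfunction A (2 * \<gamma>3) \<phi>" "Q = merw_kernel A (2 * \<gamma>3) \<phi>"
      unfolding is_merw_def comb_spectral_radius by blast
    obtain \<mu> where \<mu>: "\<And>x. \<phi> x = \<phi> Origin * \<psi>mix \<mu> x"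
      by (rule pos_eigenfunction_cases[OF \<phi>(1)]) (rule that)
    have "\<phi> Origin > 0"
      using \<phi>(1) by (simp add: pos_eigenfunction_def)
    have "\<phi> y / (2 * \<gamma>3 * \<phi> x) = \<psi>mix \<mu> y / (2 * \<gamma>3 * \<psi>mix \<mu> x)" for x y
      unfolding \<mu>[of x] \<mu>[of y] using \<open>\<phi> Origin > 0\<close> by simp
    then have "Q = merw \<mu>"
      unfolding \<phi>(2) merw_def merw_kernel_def by simp
    then show "Q \<in> range merw" by simp
  qed
  ultimately show ?thesis
    by (simp add: bij_betw_def)
qed

section \<open>Action of the kernels on functions, and superharmonic functions\<close>

lemma merw_nonneg: "0 \<le> merw \<mu> x y"
  using \<gamma>3_pos \<psi>mix_pos[of \<mu> x] \<psi>mix_pos[of \<mu> y] by (simp add: merw_def merw_kernel_def)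

text \<open>The kernel is a Doob transform of \<open>A\<close>: on a quotient
  \<open>f / \<psi>mix\<close> the factors \<open>\<psi>mix \<mu> y\<close> cancel. Stochasticity
  and superharmonicity thus reduce to statements about \<open>A\<close>.\<close>

lemma nn_integral_merw:
  assumes "\<And>y. 0 \<le> f y"
  shows "(\<integral>\<^sup>+ y. ennreal (merw \<mu> x y) * ennreal (f y / \<psi>mix \<mu> y) \<partial>count_space UNIV) =
    ennreal (mat_app A f x / (2 * \<gamma>3 * \<psi>mix \<mu> x))"
proof -
  have eq: "merw \<mu> x y * (f y / \<psi>mix \<mu> y) = A x y * f y / (2 * \<gamma>3 * \<psi>mix \<mu> x)" for y
    using \<psi>mix_pos[of \<mu> y] by (simp add: merw_def merw_kernel_def)
  have nn: "ennreal (merw \<mu> x y) * ennreal (f y / \<psi>mix \<mu> y) =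
      ennreal (A x y * f y / (2 * \<gamma>3 * \<psi>mix \<mu> x))" for y
    using assms[of y] \<psi>mix_pos[of \<mu> y] merw_nonneg[of \<mu> x y]
    by (subst eq[symmetric]) (simp only: ennreal_mult[symmetric] divide_nonneg_pos)
  have "(\<integral>\<^sup>+ y. ennreal (merw \<mu> x y) * ennreal (f y / \<psi>mix \<mu> y) \<partial>count_space UNIV) =
      (\<Sum>y\<in>nbrs x. ennreal (A x y * f y / (2 * \<gamma>3 * \<psi>mix \<mu> x)))"
    unfolding nn
    by (rule nn_integral_count_space') (auto simp: spider_adj_outside_nbrs)
  also have "\<dots> = ennreal (mat_app A f x / (2 * \<gamma>3 * \<psi>mix \<mu> x))"
    using assms \<gamma>3_pos \<psi>mix_pos[of \<mu> x]
    by (subst sum_ennreal) (auto simp: mat_app_spider_adj sum_divide_distrib less_imp_le)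
  finally show ?thesis .
qed

lemma stochastic_merw: "stochastic (merw \<mu>)"
proof -
  have "(\<integral>\<^sup>+ y. ennreal (merw \<mu> x y) \<partial>count_space UNIV) = 1" for x
  proof -
    have "(\<integral>\<^sup>+ y. ennreal (merw \<mu> x y) \<partial>count_space UNIV) =
        (\<integral>\<^sup>+ y. ennreal (merw \<mu> x y) * ennreal (\<psi>mix \<mu> y / \<psi>mix \<mu> y) \<partial>count_space UNIV)"
      using \<psi>mix_pos[of \<mu>] by (intro nn_integral_cong) (simp add: less_imp_neq[THEN not_sym])
    also have "\<dots> = ennreal (mat_app A (\<psi>mix \<mu>) x / (2 * \<gamma>3 * \<psi>mix \<mu> x))"
      using \<psi>mix_pos[of \<mu>] by (intro nn_integral_merw) (simp add: less_imp_le)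
    also have "mat_app A (\<psi>mix \<mu>) x = 2 * \<gamma>3 * \<psi>mix \<mu> x"
      using pos_eigenfunction_\<psi>mix by (simp add: pos_eigenfunction_def)
    finally show ?thesis
      using \<psi>mix_pos[of \<mu> x] \<gamma>3_pos by simp
  qed
  then show ?thesis
    using merw_nonneg by (simp add: stochastic_def)
qed

lemma nn_integral_merw_superharmonic:
  assumes "\<And>y. 0 \<le> f y" and "mat_app A f x + e \<le> 2 * \<gamma>3 * f x" and "e \<ge> 0"
  shows "(\<integral>\<^sup>+ y. ennreal (merw \<mu> x y) * ennreal (f y / \<psi>mix \<mu> y) \<partial>count_space UNIV)
      + ennreal (e / (2 * \<gamma>3 * \<psi>mix \<mu> x)) \<le> ennreal (f x / \<psi>mix \<mu> x)"
proof -
  have "0 \<le> mat_app A f x"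
    unfolding mat_app_spider_adj by (intro sum_nonneg) (simp add: assms(1))
  have "mat_app A f x / (2 * \<gamma>3 * \<psi>mix \<mu> x) + e / (2 * \<gamma>3 * \<psi>mix \<mu> x) \<le> f x / \<psi>mix \<mu> x"
    using divide_right_mono[OF assms(2), of "2 * \<gamma>3 * \<psi>mix \<mu> x"] \<gamma>3_pos \<psi>mix_pos[of \<mu> x]
    by (simp add: add_divide_distrib)
  then show ?thesis
    using \<open>0 \<le> mat_app A f x\<close> \<gamma>3_pos \<psi>mix_pos[of \<mu> x] assms(3)
    by (subst nn_integral_merw[OF assms(1)]) (simp add: ennreal_leI ennreal_plus[symmetric] del: ennreal_plus)
qed

text \<open>For \<open>z\<close> at level \<open>m\<close> of leg \<open>k\<close>, the function
  \<open>f\<close> is \<open>\<psi> k\<close> frozen beyond level \<open>m\<close>. It remains an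
  eigenfunction except at the kink. For \<open>m = 0\<close> it is constant, with deficit \<Lambda>
  at the origin.\<close>

lemma strictly_superharmonic_at:
  obtains f :: "'k spider \<Rightarrow> real" and e :: real
  where "e > 0" "\<And>x. 0 \<le> f x"
    "\<And>x. mat_app A f x + (if x = z then e else 0) \<le> 2 * \<gamma>3 * f x"
proof -
  obtain m k where z: "z = vtx m k"
    using vtx_cases[of z] by blast
  define c where "c = \<Lambda> / \<gamma>2 k"
  have c: "c > 0" "\<gamma>2 k * c = \<Lambda>"
    using \<gamma>2_pos[of k] drift_pos by (auto simp: c_def)
  \<comment> \<open>The range of \<open>vtx\<close> at \<open>k\<close> is leg \<open>k\<close>
    together with the origin, where the additional term vanishes.\<close>
  define f where "f x = 1 + (if x \<in> range (\<lambda>n. vtx n k) then c * real (min (level x) m) else 0)" for x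
  have mem: "vtx n j \<in> range (\<lambda>n. vtx n k) \<longleftrightarrow> n = 0 \<or> j = k" for n j
    by (auto simp: vtx_eq_iff image_iff)
  have f: "f (vtx n j) = 1 + (if j = k then c * real (min n m) else 0)" for n j
    unfolding f_def mem by auto
  \<comment> \<open>The deficit at \<open>z\<close> is \<Lambda> if \<open>z\<close> is the origin
    and \<open>\<gamma>3 * c\<close> otherwise; the minimum serves both cases.\<close>
  define e where "e = min \<Lambda> (\<gamma>3 * c)"
  have "mat_app A f x + (if x = z then e else 0) \<le> 2 * \<gamma>3 * f x" for x
  proof (cases x)
    case Origin
    have "\<gamma>2 j * f (Leg 0 j) = \<gamma>2 j + (if j = k then \<Lambda> * real (min 1 m) else 0)" for j
      using f[of 1 j] c(2) by (simp add: algebra_simps)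
    moreover have f0: "f Origin = 1"
      using f[of 0 k] by simp
    ultimately have "mat_app A f Origin = \<gamma>1 + (\<Sum>j\<in>UNIV. \<gamma>2 j) + \<Lambda> * real (min 1 m)"
      by (simp add: mat_app_Origin sum.distrib)
    moreover have "Origin = z \<longleftrightarrow> m = 0"
      using vtx_eq_iff[of 0 k m k] by (auto simp: z)
    ultimately show ?thesis
      using sum_weights f0 drift_pos by (auto simp: Origin e_def)
  next
    case (Leg n j)
    have x: "x = vtx (Suc n) j"
      by (simp add: Leg)
    have app: "mat_app A f x = \<gamma>3 * (f (vtx (Suc (Suc n)) j) + f (vtx n j))"
      by (simp add: Leg mat_app_Leg)
    show ?thesis
    proof (cases "j = k")
      case False
      then have "x \<noteq> z" unfolding x z vtx_eq_iff by simp
      moreover have "f x = 1" "mat_app A f x = 2 * \<gamma>3"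
        unfolding app unfolding x f using False by simp_all
      ultimately show ?thesis by simp
    next
      case True
      \<comment> \<open>The truncated level has second difference \<open>-1\<close> at the kink and
        \<open>0\<close> at the other positive levels.\<close>
      have min: "real (min (Suc (Suc n)) m) + real (min n m) =
          2 * real (min (Suc n) m) - (if Suc n = m then 1 else 0)"
        by (auto simp: min_def)
      have "mat_app A f x = 2 * \<gamma>3 + \<gamma>3 * c * (real (min (Suc (Suc n)) m) + real (min n m))"
        using True by (simp only: app f) (simp add: algebra_simps)
      also have "\<dots> = 2 * \<gamma>3 * f x - (if Suc n = m then \<gamma>3 * c else 0)"
        using True unfolding min x f by (auto simp: algebra_simps)
      finally have "mat_app A f x = 2 * \<gamma>3 * f x - (if Suc n = m then \<gamma>3 * c else 0)" .
      moreover have "x = z \<longleftrightarrow> Suc n = m"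
        unfolding x z vtx_eq_iff using True by simp
      ultimately show ?thesis
        by (auto simp: e_def)
    qed
  qed
  moreover have "e > 0"
    using c \<gamma>3_pos drift_pos by (simp add: e_def)
  moreover have "0 \<le> f x" for x
    using c by (simp add: f_def)
  ultimately show ?thesis
    using that by blast
qed

end

section \<open>Convergence to the ends and the law of the limit\<close>

lemma tends_to_end_unique:
  assumes "tends_to_end \<omega> k" and "tends_to_end \<omega> l"
  shows "k = l"
proof -
  \<comment> \<open>Distinct legs meet only at the origin, which the bound on the level
    excludes.\<close>
  have "\<forall>\<^sub>F n in sequentially. (\<exists>m. \<omega> n = vtx m k) \<and> (\<exists>m. \<omega> n = vtx m l) \<and> level (\<omega> n) \<ge> 1"
    using assms unfolding tends_to_end_def filterlim_at_top
    by (intro eventually_conj) auto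
  then have "\<exists>n. (\<exists>m. \<omega> n = vtx m k) \<and> (\<exists>m. \<omega> n = vtx m l) \<and> level (\<omega> n) \<ge> 1"
    by (rule eventually_happens'[OF sequentially_bot])
  then obtain n m m' where "\<omega> n = vtx m k" "\<omega> n = vtx m' l" "level (\<omega> n) \<ge> 1"
    by blast
  then show ?thesis
    using vtx_eq_iff[of m k m' l] by auto
qed

text \<open>Only finitely many vertices lie below a given level, so leaving each of them for good
  sends the level to infinity. After the last visit to the origin the path cannot change
  legs.\<close>

lemma transient_path_tends_to_end:
  fixes \<omega> :: "nat \<Rightarrow> 'k::finite spider"
  assumes leaves: "\<And>z. \<forall>\<^sub>F n in sequentially. \<omega> n \<noteq> z"
    and path: "\<And>n. spider_adj \<gamma>1 \<gamma>2 \<gamma>3 (\<omega> n) (\<omega> (Suc n)) \<noteq> 0"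
  shows "\<exists>k. tends_to_end \<omega> k"
proof -
  have "\<forall>\<^sub>F n in sequentially. level (\<omega> n) \<ge> L" for L
  proof -
    let ?Z = "(\<lambda>(n, k). vtx n k) ` ({..<L} \<times> (UNIV :: 'k set))"
    have "x \<in> ?Z" if "\<not> level x \<ge> L" for x :: "'k spider"
    proof -
      obtain n k where x: "x = vtx n k"
        using vtx_cases[of x] by blast
      then show ?thesis using that by force
    qed
    then have "L \<le> level (\<omega> n)" if "\<forall>z\<in>?Z. \<omega> n \<noteq> z" for n
      using that by blast
    moreover have "\<forall>\<^sub>F n in sequentially. \<forall>z\<in>?Z. \<omega> n \<noteq> z"
      by (rule eventually_ball_finite) (auto intro: leaves)
    ultimately show ?thesis
      by (rule eventually_mono[rotated])
  qed
  then have lim: "filterlim (\<lambda>n. level (\<omega> n)) at_top sequentially"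
    by (simp add: filterlim_at_top)
  obtain N where N: "\<And>n. n \<ge> N \<Longrightarrow> \<omega> n \<noteq> Origin"
    using leaves[of Origin] by (auto simp: eventually_sequentially)
  obtain m k where "\<omega> N = Leg m k"
    using N[of N] by (cases "\<omega> N") auto
  have "\<exists>m. \<omega> (N + n) = Leg m k" for n
  proof (induction n)
    case 0
    then show ?case using \<open>\<omega> N = Leg m k\<close> by simp
  next
    case (Suc n)
    then obtain m where "\<omega> (N + n) = Leg m k" by blast
    then show ?case
      using path[of "N + n"] N[of "N + Suc n"]
      by (cases "\<omega> (N + Suc n)") (auto split: if_splits)
  qed
  then have "\<exists>m. \<omega> n = vtx m k" if "n \<ge> N" for n
    using that by (metis le_add_diff_inverse vtx.simps(2))
  then have "tends_to_end \<omega> k"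
    using lim by (auto simp: tends_to_end_def eventually_sequentially)
  then show ?thesis ..
qed

locale spider_walk = spider \<gamma>1 \<gamma>3 \<gamma>2 + markov_chain "merw \<mu>" Origin M
  for \<gamma>1 \<gamma>3 :: real and \<gamma>2 :: "'k::finite \<Rightarrow> real" and \<mu> :: "'k pmf" and M
begin

lemma AE_tends_to_end: "AE \<omega> in M. \<exists>k. tends_to_end \<omega> k"
proof -
  have "AE \<omega> in M. \<forall>\<^sub>F n in sequentially. \<omega> n \<noteq> z" for z
  proof -
    obtain f and e :: real where f: "e > 0" "\<And>x. 0 \<le> f x"
      "\<And>x. mat_app A f x + (if x = z then e else 0) \<le> 2 * \<gamma>3 * f x"
      by (rule strictly_superharmonic_at[of z]) (rule that)
    show ?thesis
    proof (rule AE_eventually_leaves[where u = "\<lambda>x. f x / \<psi>mix \<mu> x"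
          and e = "e / (2 * \<gamma>3 * \<psi>mix \<mu> z)"])
      show "0 \<le> f x / \<psi>mix \<mu> x" for x
        using f(2)[of x] \<psi>mix_pos[of \<mu> x] by simp
      show "e / (2 * \<gamma>3 * \<psi>mix \<mu> z) > 0"
        using f(1) \<gamma>3_pos \<psi>mix_pos[of \<mu> z] by simp
      fix y
      have "ennreal (e / (2 * \<gamma>3 * \<psi>mix \<mu> z)) * indicator {z} y =
          ennreal ((if y = z then e else 0) / (2 * \<gamma>3 * \<psi>mix \<mu> y))"
        by auto
      then show "(\<integral>\<^sup>+ w. ennreal (merw \<mu> y w) * ennreal (f w / \<psi>mix \<mu> w) \<partial>count_space UNIV) +
          ennreal (e / (2 * \<gamma>3 * \<psi>mix \<mu> z)) * indicator {z} y \<le> ennreal (f y / \<psi>mix \<mu> y)"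
        using nn_integral_merw_superharmonic[OF f(2) f(3), of y \<mu>] f(1) by (simp only:) simp
    qed
  qed
  then have "AE \<omega> in M. \<forall>z. \<forall>\<^sub>F n in sequentially. \<omega> n \<noteq> z"
    by (simp add: AE_all_countable)
  with AE_P_pos show ?thesis
  proof eventually_elim
    case (elim \<omega>)
    have "A (\<omega> n) (\<omega> (Suc n)) \<noteq> 0" for n
      using elim(1)[rule_format, of n] by (auto simp: merw_def merw_kernel_def)
    then show ?case
      using elim(2) by (intro transient_path_tends_to_end) auto
  qed
qed

lemma sets_tends_to_end: "{\<omega>. tends_to_end \<omega> k} \<in> sets M"
proof -
  have coord: "Measurable.pred M (\<lambda>\<omega>. Q (\<omega> n))" for Q n
    by (rule measurable_compose[OF measurable_coord]) simp
  show ?thesis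
    unfolding tends_to_end_def filterlim_at_top eventually_sequentially
    by (rule sets_Collect_M) (auto intro!: pred_intros_logic pred_intros_countable coord)
qed

lemma prob_tends_to_end_le: "prob {\<omega>. tends_to_end \<omega> k} \<le> pmf \<mu> k"
proof (rule ccontr)
  let ?E = "{\<omega>. tends_to_end \<omega> k}"
  assume less: "\<not> prob ?E \<le> pmf \<mu> k"
  \<comment> \<open>\<open>1 / b\<close> is the midpoint between \<open>pmf \<mu> k\<close> and the
    supposedly larger probability. A finite threshold \<open>b\<close> also covers
    \<open>pmf \<mu> k = 0\<close>, where the quotient tends to infinity along leg
    \<open>k\<close>.\<close>
  define b where "b = 2 / (prob ?E + pmf \<mu> k)"
  have pos: "prob ?E + pmf \<mu> k > 0"
    using less pmf_nonneg[of \<mu> k] by linarith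
  have b: "b > 0" "b * pmf \<mu> k < 1" "b * prob ?E > 1"
    using less pos by (auto simp: b_def field_simps)
  have "b * prob ?E \<le> \<psi> k Origin / \<psi>mix \<mu> Origin"
  proof (rule prob_le_of_superharmonic[where u = "\<lambda>x. \<psi> k x / \<psi>mix \<mu> x"])
    have \<psi>_pos: "\<psi> k x > 0" and eigen: "mat_app A (\<psi> k) x = 2 * \<gamma>3 * \<psi> k x" for x
      using pos_eigenfunction_\<psi>[of k] by (auto simp: pos_eigenfunction_def)
    show "0 \<le> \<psi> k x / \<psi>mix \<mu> x" for x
      using \<psi>_pos[of x] \<psi>mix_pos[of \<mu> x] by simp
    show "(\<integral>\<^sup>+ w. ennreal (merw \<mu> y w) * ennreal (\<psi> k w / \<psi>mix \<mu> w) \<partial>count_space UNIV)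
        \<le> ennreal (\<psi> k y / \<psi>mix \<mu> y)" for y
      using nn_integral_merw_superharmonic[of "\<psi> k" y 0 \<mu>] \<psi>_pos eigen
      by (simp add: less_imp_le)
    show "\<forall>\<^sub>F n in sequentially. b \<le> \<psi> k (\<omega> n) / \<psi>mix \<mu> (\<omega> n)" if "\<omega> \<in> ?E" for \<omega>
    proof -
      define c where "c = \<Lambda> / \<gamma>2 k"
      have "c > 0" using \<gamma>2_pos[of k] drift_pos by (simp add: c_def)
      \<comment> \<open>At level \<open>m\<close> of leg \<open>k\<close> the quotient is at least
        \<open>b\<close> as soon as \<open>m * (c * (1 - b * pmf \<mu> k))\<close> is at least
        \<open>b - 1\<close>; levels from \<open>L\<close> on satisfy this.\<close>
      obtain L :: nat where L: "b < real L * (c * (1 - b * pmf \<mu> k))"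
        using reals_Archimedean3[of "c * (1 - b * pmf \<mu> k)"] \<open>c > 0\<close> b by auto
      have "\<forall>\<^sub>F n in sequentially. (\<exists>m. \<omega> n = vtx m k) \<and> level (\<omega> n) \<ge> L"
        using that unfolding tends_to_end_def filterlim_at_top by (auto intro: eventually_conj)
      then show ?thesis
      proof eventually_elim
        case (elim n)
        then obtain m where m: "\<omega> n = vtx m k" "m \<ge> L" by auto
        have "real L * (c * (1 - b * pmf \<mu> k)) \<le> real m * (c * (1 - b * pmf \<mu> k))"
          using m(2) b \<open>c > 0\<close> by (intro mult_right_mono) auto
        then have "b * (1 + pmf \<mu> k * c * real m) \<le> 1 + c * real m"
          using L by (simp add: algebra_simps)
        then have "b * \<psi>mix \<mu> (\<omega> n) \<le> \<psi> k (\<omega> n)"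
          by (simp add: m \<psi>mix_vtx \<psi>_vtx c_def)
        then show ?case
          using \<psi>mix_pos[of \<mu> "\<omega> n"] by (simp add: field_simps)
      qed
    qed
  qed (use b in \<open>auto simp: sets_tends_to_end\<close>)
  moreover have "\<psi>mix \<mu> Origin = 1"
    using \<psi>mix_vtx[of \<mu> 0] by simp
  ultimately show False
    using b by simp
qed

lemma prob_tends_to_end: "prob {\<omega>. tends_to_end \<omega> k} = pmf \<mu> k"
proof -
  let ?E = "\<lambda>k. {\<omega>. tends_to_end \<omega> k}"
  have "(\<Sum>k\<in>UNIV. prob (?E k)) = prob (\<Union>k. ?E k)"
    by (rule finite_measure_finite_Union[symmetric])
      (auto simp: sets_tends_to_end disjoint_family_on_def dest: tends_to_end_unique)
  also have "\<dots> = 1"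
  proof (subst prob_eq_1)
    show "(\<Union>k. ?E k) \<in> sets M"
      by (intro sets.finite_UN) (auto simp: sets_tends_to_end)
    show "AE \<omega> in M. \<omega> \<in> (\<Union>k. ?E k)"
      using AE_tends_to_end by simp
  qed
  finally have "(\<Sum>k\<in>UNIV. pmf \<mu> k - prob (?E k)) = 0"
    by (simp add: sum_subtractf sum_pmf_eq_1)
  then have "pmf \<mu> k - prob (?E k) = 0"
    by (subst (asm) sum_nonneg_eq_0_iff) (auto simp: prob_tends_to_end_le)
  then show ?thesis by simp
qed

end

text \<open>Distributions carried by two fixed legs are told apart by the weight of one of them, an
  arbitrary number in the unit interval. With a single leg there is only one distribution.\<close>

lemma infinite_pmf:
  assumes "CARD('k::finite) \<ge> 2"
  shows "infinite (UNIV :: 'k pmf set)"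
proof -
  obtain i j :: 'k where "i \<noteq> j"
    using assms card_le_Suc0_iff_eq[of "UNIV :: 'k set"] by force
  define F where "F p = map_pmf (\<lambda>b. if b then i else j) (bernoulli_pmf p)" for p
  have "pmf (F p) i = p" if "p \<in> {0..1}" for p
  proof -
    have "pmf (F p) i = pmf (F p) ((\<lambda>b. if b then i else j) True)"
      by simp
    also have "\<dots> = pmf (bernoulli_pmf p) True"
      unfolding F_def using \<open>i \<noteq> j\<close> by (intro pmf_map_inj') (auto simp: inj_def)
    finally show ?thesis using that by simp
  qed
  then have "inj_on F {0..1}"
    by (metis inj_onI)
  moreover have "infinite {0..1::real}"
    by (simp add: infinite_Icc)
  ultimately show ?thesis
    by (metis finite_imageD finite_subset top_greatest)
qed

theorem proposition3p4:
  fixes \<gamma>1 \<gamma>3 \<Lambda> :: real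
    and \<gamma>2 :: "'k::finite \<Rightarrow> real"
    and A :: "'k spider \<Rightarrow> 'k spider \<Rightarrow> real"
    and \<psi> :: "'k \<Rightarrow> 'k spider \<Rightarrow> real"
    and \<psi>mix :: "'k pmf \<Rightarrow> 'k spider \<Rightarrow> real"
    and P :: "'k pmf \<Rightarrow> 'k spider \<Rightarrow> 'k spider \<Rightarrow> real"
  defines "\<Lambda> \<equiv> spider_drift \<gamma>1 \<gamma>2 \<gamma>3"
    and "A \<equiv> spider_adj \<gamma>1 \<gamma>2 \<gamma>3"
    and "\<psi> \<equiv> spider_psi \<gamma>1 \<gamma>2 \<gamma>3"
    and "\<psi>mix \<equiv> spider_psi_mix \<gamma>1 \<gamma>2 \<gamma>3"
    and "P \<equiv> (\<lambda>\<mu>. merw_kernel (spider_adj \<gamma>1 \<gamma>2 \<gamma>3) (2 * \<gamma>3) (spider_psi_mix \<gamma>1 \<gamma>2 \<gamma>3 \<mu>))"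
  assumes "\<gamma>1 \<ge> 0" and "\<And>k. \<gamma>2 k > 0" and "\<gamma>3 > 0" and "\<Lambda> > 0"
  shows
    "is_comb_spectral_radius A (2 * \<gamma>3)
     \<and> (\<forall>i k n. \<psi> i (vtx n k) = 1 + (if i = k then 1 else 0) * (\<Lambda> / \<gamma>2 k) * real n)
     \<and> (\<forall>i. pos_eigenfunction A (2 * \<gamma>3) (\<psi> i))
     \<and> (\<forall>c. (\<forall>x. (\<Sum>i\<in>UNIV. c i * \<psi> i x) = 0) \<longrightarrow> (\<forall>i. c i = 0))
     \<and> (\<forall>\<mu>. pos_eigenfunction A (2 * \<gamma>3) (\<psi>mix \<mu>))
     \<and> bij_betw P UNIV {Q. is_merw A Q}
     \<and> (CARD('k) \<ge> 2 \<longrightarrow> infinite {Q. is_merw A Q})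
     \<and> (\<forall>\<mu> k n. n \<ge> 1 \<longrightarrow>
          P \<mu> (vtx n k) (vtx (n + 1) k)
            = 1 / 2 * ((\<gamma>2 k + pmf \<mu> k * \<Lambda> * (real n + 1)) / (\<gamma>2 k + pmf \<mu> k * \<Lambda> * real n))
        \<and> P \<mu> (vtx n k) (vtx (n - 1) k)
            = 1 / 2 * ((\<gamma>2 k + pmf \<mu> k * \<Lambda> * (real n - 1)) / (\<gamma>2 k + pmf \<mu> k * \<Lambda> * real n)))
     \<and> (\<forall>\<mu> k. P \<mu> Origin (vtx 1 k) = (\<gamma>2 k + pmf \<mu> k * \<Lambda>) / (2 * \<gamma>3))
     \<and> (\<forall>\<mu>. P \<mu> Origin Origin = \<gamma>1 / (2 * \<gamma>3))
     \<and> (\<forall>\<mu>. \<exists>M. is_markov_law (P \<mu>) Origin M)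
     \<and> (\<forall>\<mu> M. is_markov_law (P \<mu>) Origin M \<longrightarrow>
          (\<forall>k. measure M {\<omega> \<in> space M. tends_to_end \<omega> k} = pmf \<mu> k))"
proof -
  interpret spider \<gamma>1 \<gamma>3 \<gamma>2
    using assms by unfold_locales auto
  have P: "P = merw"
    by (auto simp: assms(5) merw_def)
  have law: "measure M {\<omega> \<in> space M. tends_to_end \<omega> k} = pmf \<mu> k"
    if "is_markov_law (merw \<mu>) Origin M" for \<mu> M k
  proof -
    interpret spider_walk \<gamma>1 \<gamma>3 \<gamma>2 \<mu> M
      using that by unfold_locales (rule stochastic_merw)
    show ?thesis
      using prob_tends_to_end[of k] by simp
  qed
  have infinite: "infinite {Q. is_merw (spider_adj \<gamma>1 \<gamma>2 \<gamma>3) Q}" if "CARD('k) \<ge> 2"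
    using bij_betw_finite[OF bij_betw_merw] infinite_pmf[OF that] by simp
  have up: "merw \<mu> (vtx n k) (vtx (n + 1) k) = 1 / 2 *
      ((\<gamma>2 k + pmf \<mu> k * spider_drift \<gamma>1 \<gamma>2 \<gamma>3 * (real n + 1)) /
       (\<gamma>2 k + pmf \<mu> k * spider_drift \<gamma>1 \<gamma>2 \<gamma>3 * real n))"
    if "n \<ge> 1" for \<mu> k n
    using merw_vtx[OF that, of "n + 1" \<mu> k] by (simp add: add.commute)
  \<comment> \<open>For \<open>n \<ge> 1\<close> the natural number \<open>n - 1\<close> agrees with
    the real difference.\<close>
  have down: "merw \<mu> (vtx n k) (vtx (n - 1) k) = 1 / 2 *
      ((\<gamma>2 k + pmf \<mu> k * spider_drift \<gamma>1 \<gamma>2 \<gamma>3 * (real n - 1)) /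
       (\<gamma>2 k + pmf \<mu> k * spider_drift \<gamma>1 \<gamma>2 \<gamma>3 * real n))"
    if "n \<ge> 1" for \<mu> k n
    using merw_vtx[OF that, of "n - 1" \<mu> k] that by (simp add: of_nat_diff)
  show ?thesis
    unfolding P \<Lambda>_def A_def \<psi>_def \<psi>mix_def
    by (intro conjI allI impI)
      (use \<psi>_independent in \<open>auto simp: comb_spectral_radius \<psi>_vtx pos_eigenfunction_\<psi>
        pos_eigenfunction_\<psi>mix bij_betw_merw infinite up[simplified] down[simplified]
        merw_Origin_Leg[simplified] merw_Origin_Origin law markov_law_exists stochastic_merw\<close>)
qed

end
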